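(* For $m\in\{4,5\}$ one has $\gamma_m(K_1)=1$.
   Context: $K_1=\{(x_1,x_2,x_3)\in\mathbb{R}^3: |x_1|+|x_2|+|x_3|\le 1\}$ is the unit crosspolytope in three-dimensional Euclidean space $\mathbb{E}^3$. For a convex body (compact convex set with non-empty interior) $K\subset\mathbb{E}^n$ and a positive integer $m$, $\gamma_m(K)$ denotes the smallest positive number $\lambda$ such that $K$ can be covered by $m$ translates of $\lambda K$: $$\gamma_m(K)=\min\Big\{\lambda>0:\ \exists\,\boldsymbol u_1,\dots,\boldsymbol u_m\in\mathbb{E}^n \text{ such that } K\subseteq\bigcup_{i=1}^m(\lambda K+\boldsymbol u_i)\Big\}.$$ *)

theory Defs
  imports "HOL-Analysis.Analysis"
begin

definition crosspolytope3 :: "(real ^ 3) set" where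
  "crosspolytope3 = {x. \<bar>x $ 1\<bar> + \<bar>x $ 2\<bar> + \<bar>x $ 3\<bar> \<le> 1}"

definition covered_by_translates :: "nat \<Rightarrow> 'a::euclidean_space set \<Rightarrow> real \<Rightarrow> bool" where
  "covered_by_translates m K l \<longleftrightarrow>
     (\<exists>u :: nat \<Rightarrow> 'a. K \<subseteq> (\<Union>i\<in>{1..m}. (\<lambda>x. l *\<^sub>R x + u i) ` K))"

text \<open>
  The covering functional is a minimum, not merely an infimum: on the reals, the LEAST
  operator is only specified when the minimum is attained, so proving that it has a given
  value requires showing that this value is an admissible ratio. For a convex body K and
  positive m the minimum always exists.
\<close>

definition covering_functional :: "nat \<Rightarrow> 'a::euclidean_space set \<Rightarrow> real" where
  "covering_functional m K = (LEAST l. l > 0 \<and> covered_by_translates m K l)"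

end

theory Submission
  imports Defs
begin

text \<open>
  The crosspolytope is the unit ball of the \<open>\<ell>\<^sub>1\<close> norm, so a translate of its \<open>l\<close>-fold
  multiple has \<open>\<ell>\<^sub>1\<close> diameter \<open>2 * l\<close> (\<open>l1_dist3_translate_le\<close>). Its six vertices, the signed unit vectors, are at
  \<open>\<ell>\<^sub>1\<close> distance exactly 2 from each other, for opposite vertices as well as for
  vertices on different axes (\<open>l1_dist3_vertices\<close>). Hence for \<open>l < 1\<close> a translate contains at most one
  vertex, and by the pigeonhole principle (\<open>separated_points_not_covered\<close>) five translates cannot contain all six. The ratio 1
  is attained by the crosspolytope itself.
\<close>

text \<open>
  Pigeonhole: assigning to each point a translate that contains it would be an injection of
  the more than \<open>m\<close> points into \<open>m\<close> translates. The points are given as an indexed family, so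
  that their number can be read off from the index set; separation makes the family injective.
\<close>

lemma separated_points_not_covered:
  fixes K :: "'a::euclidean_space set" and p :: "'b \<Rightarrow> 'a"
  assumes "finite I" "m < card I" "p ` I \<subseteq> K"
    and separated: "\<And>i j u. \<lbrakk>i \<in> I; j \<in> I; p i \<in> (\<lambda>x. l *\<^sub>R x + u) ` K; p j \<in> (\<lambda>x. l *\<^sub>R x + u) ` K\<rbrakk> \<Longrightarrow> i = j"
  shows "\<not> covered_by_translates m K l"
proof
  assume "covered_by_translates m K l"
  then obtain u :: "nat \<Rightarrow> 'a" where "K \<subseteq> (\<Union>k\<in>{1..m}. (\<lambda>x. l *\<^sub>R x + u k) ` K)"
    unfolding covered_by_translates_def by blast
  with assms(3) have "\<forall>i\<in>I. \<exists>k. k \<in> {1..m} \<and> p i \<in> (\<lambda>x. l *\<^sub>R x + u k) ` K"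
    by blast
  then obtain c where c: "\<forall>i\<in>I. c i \<in> {1..m} \<and> p i \<in> (\<lambda>x. l *\<^sub>R x + u (c i)) ` K"
    by metis
  then have "inj_on c I"
    by (metis inj_onI separated)
  moreover have "c ` I \<subseteq> {1..m}"
    using c by blast
  ultimately have "card I \<le> card {1..m}"
    by (meson card_inj_on_le finite_atLeastAtMost)
  with assms(2) show False
    by simp
qed

definition l1_dist3 :: "real ^ 3 \<Rightarrow> real ^ 3 \<Rightarrow> real" where
  "l1_dist3 x y = \<bar>x $ 1 - y $ 1\<bar> + \<bar>x $ 2 - y $ 2\<bar> + \<bar>x $ 3 - y $ 3\<bar>"

text \<open>
  Translation preserves \<open>l1_dist3\<close> and scaling multiplies it by \<open>l\<close>, so the bound reduces to
  the triangle inequality through the centre of the unit ball.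
\<close>

lemma l1_dist3_translate_le:
  assumes "l > 0"
    and "x \<in> (\<lambda>z. l *\<^sub>R z + u) ` crosspolytope3" "y \<in> (\<lambda>z. l *\<^sub>R z + u) ` crosspolytope3"
  shows "l1_dist3 x y \<le> 2 * l"
proof -
  obtain a b where ab: "x = l *\<^sub>R a + u" "y = l *\<^sub>R b + u" "a \<in> crosspolytope3" "b \<in> crosspolytope3"
    using assms by blast
  have "\<bar>x $ i - y $ i\<bar> = l * \<bar>a $ i - b $ i\<bar>" for i
    using \<open>l > 0\<close> by (simp add: ab abs_mult flip: right_diff_distrib)
  then have "l1_dist3 x y = l * l1_dist3 a b"
    by (simp add: l1_dist3_def distrib_left)
  also have "l1_dist3 a b \<le> 2"
    using ab(3,4) unfolding crosspolytope3_def l1_dist3_def by simp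
  finally show ?thesis
    using \<open>l > 0\<close> by (simp add: mult.commute)
qed

definition crosspolytope3_vertex :: "3 \<times> bool \<Rightarrow> real ^ 3" where
  "crosspolytope3_vertex v = axis (fst v) (if snd v then 1 else - 1)"

lemma crosspolytope3_vertex_mem: "crosspolytope3_vertex v \<in> crosspolytope3"
  using exhaust_3[of "fst v"]
  by (auto simp: crosspolytope3_def crosspolytope3_vertex_def axis_def)

lemma l1_dist3_vertices:
  assumes "v \<noteq> w"
  shows "l1_dist3 (crosspolytope3_vertex v) (crosspolytope3_vertex w) = 2"
  using assms exhaust_3[of "fst v"] exhaust_3[of "fst w"]
  by (auto simp: l1_dist3_def crosspolytope3_vertex_def axis_def prod_eq_iff)

lemma crosspolytope3_not_covered:
  assumes "m < 6" "0 < l" "l < 1"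
  shows "\<not> covered_by_translates m crosspolytope3 l"
proof (rule separated_points_not_covered)
  show "m < card (UNIV :: (3 \<times> bool) set)"
    using \<open>m < 6\<close> by (simp add: card_UNIV_bool flip: UNIV_Times_UNIV)
  show "range crosspolytope3_vertex \<subseteq> crosspolytope3"
    using crosspolytope3_vertex_mem by blast
  show "v = w" if "crosspolytope3_vertex v \<in> (\<lambda>x. l *\<^sub>R x + u) ` crosspolytope3"
    "crosspolytope3_vertex w \<in> (\<lambda>x. l *\<^sub>R x + u) ` crosspolytope3" for v w u
    using l1_dist3_translate_le[OF \<open>0 < l\<close> that] l1_dist3_vertices[of v w] \<open>l < 1\<close> by fastforce
qed simp

lemma covered_by_translates_1:
  assumes "0 < m"
  shows "covered_by_translates m K 1"
  unfolding covered_by_translates_def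
  using assms by (intro exI[of _ "\<lambda>_. 0"]) auto

theorem theorem1p1:
  fixes m :: nat
  assumes "m \<in> {4, 5}"
  shows "covering_functional m crosspolytope3 = 1"
  unfolding covering_functional_def
proof (rule Least_equality)
  show "0 < (1::real) \<and> covered_by_translates m crosspolytope3 1"
    using assms covered_by_translates_1[of m] by auto
  show "1 \<le> l" if "0 < l \<and> covered_by_translates m crosspolytope3 l" for l
    using assms that crosspolytope3_not_covered[of m l] by force
qed

end
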